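(* A $\mathbb Z^d$ odometer on $\overleftarrow{\mathbb Z^d/A_n\mathbb Z^d}$ is conjugate to a product odometer if and only if the sequence $\{A_n\}$, or some subsequence of it (still denoted $\{A_n\}$), satisfies, for all $n\in\mathbb N$ and all $1\le k\le d$, $$m_k(A_n)\ \mid\ row_k(A_{n+1}).$$
   Context: Let $A_n\in M(d,\mathbb Z)$, $n\ge1$, be nonsingular integer matrices with $A_1\mathbb Z^d\supset A_2\mathbb Z^d\supset\cdots$ and $\bigcap_n A_n\mathbb Z^d=\{0\}$. The $\mathbb Z^d$ odometer on $\overleftarrow{\mathbb Z^d/A_n\mathbb Z^d}$ is the action of $\mathbb Z^d$ by translation on the inverse limit $\overleftarrow{\mathbb Z^d/A_n\mathbb Z^d}$ of the finite groups $\mathbb Z^d/A_n\mathbb Z^d$ under the natural quotient maps. Two $\mathbb Z^d$ odometers are conjugate if there is a $\mathbb Z^d$-equivariant homeomorphism between them. A product odometer is a $\mathbb Z^d$ odometer on $\overleftarrow{\mathbb Z^d/\Delta_n\mathbb Z^d}$ where each $\Delta_n\in M(d,\mathbb Z)$ is a nonsingular diagonal matrix. For $A\in M(d,\mathbb Z)$ and $m\in\mathbb Z$, $m\mid row_k(A)$ means that $m$ divides all the entries in the $k$th row of $A$. For nonsingular $A\in M(d,\mathbb Z)$, $m_k(A)=\min\{m\ge1: m\vec e_k\in A\mathbb Z^d\}$, where $\vec e_k$ is the $k$th standard basis vector. *)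

theory Defs
  imports "HOL-Analysis.Analysis"
begin

definition image_lattice :: "int^'d^'d \<Rightarrow> (int^'d) set" where
  "image_lattice A = range (\<lambda>v. A *v v)"

definition lattice_rel :: "int^'d^'d \<Rightarrow> (int^'d) rel" where
  "lattice_rel A = {(u, v). v - u \<in> image_lattice A}"

definition quotient_space :: "int^'d^'d \<Rightarrow> (int^'d) set set" where
  "quotient_space A = UNIV // lattice_rel A"

definition odometer_sequence :: "(nat \<Rightarrow> int^'d^'d) \<Rightarrow> bool" where
  "odometer_sequence A \<longleftrightarrow>
     (\<forall>n. det (A n) \<noteq> 0) \<and>
     (\<forall>n. image_lattice (A (Suc n)) \<subseteq> image_lattice (A n)) \<and>
     (\<Inter>n. image_lattice (A n)) = {0}"

text \<open>The inverse limit of the finite discrete quotients. The natural map from the quotient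
  by a sublattice to the quotient by a larger lattice sends a coset of the former to its
  saturation under the latter.\<close>

definition odometer :: "(nat \<Rightarrow> int^'d^'d) \<Rightarrow> (nat \<Rightarrow> (int^'d) set) topology" where
  "odometer A =
     subtopology (product_topology (\<lambda>n. discrete_topology (quotient_space (A n))) UNIV)
       {x. \<forall>n. x n = lattice_rel (A n) `` x (Suc n)}"

text \<open>Adding the class of \<open>v\<close> to the coset \<open>x n\<close> is the same as translating \<open>x n\<close>, as a set,
  by \<open>v\<close>.\<close>

definition translate :: "int^'d \<Rightarrow> (nat \<Rightarrow> (int^'d) set) \<Rightarrow> nat \<Rightarrow> (int^'d) set" where
  "translate v x = (\<lambda>n. (\<lambda>u. v + u) ` x n)"

definition conjugate_odometers ::
    "(nat \<Rightarrow> int^'d^'d) \<Rightarrow> (nat \<Rightarrow> int^'d^'d) \<Rightarrow> bool" where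
  "conjugate_odometers A B \<longleftrightarrow>
     (\<exists>h. homeomorphic_map (odometer A) (odometer B) h \<and>
          (\<forall>v. \<forall>x \<in> topspace (odometer A). h (translate v x) = translate v (h x)))"

definition diagonal_matrix :: "int^'d^'d \<Rightarrow> bool" where
  "diagonal_matrix D \<longleftrightarrow> (\<forall>i j. i \<noteq> j \<longrightarrow> D $ i $ j = 0)"

definition product_odometer_sequence :: "(nat \<Rightarrow> int^'d^'d) \<Rightarrow> bool" where
  "product_odometer_sequence D \<longleftrightarrow> odometer_sequence D \<and> (\<forall>n. diagonal_matrix (D n))"

definition axis_order :: "'d \<Rightarrow> int^'d^'d \<Rightarrow> nat" where
  "axis_order k A = (LEAST m. 1 \<le> m \<and> int m *s axis k 1 \<in> image_lattice A)"

definition dvd_row :: "int \<Rightarrow> 'd \<Rightarrow> int^'d^'d \<Rightarrow> bool" where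
  "dvd_row m k A \<longleftrightarrow> (\<forall>j. m dvd row k A $ j)"

lemma equiv_lattice_rel: "equiv UNIV (lattice_rel A)"
proof (rule equivI)
  show "refl (lattice_rel A)"
    by (auto simp: refl_on_def lattice_rel_def image_lattice_def image_iff
        intro: exI[of _ 0] matrix_vector_mult_0_right[symmetric])
  show "sym (lattice_rel A)"
  proof (rule symI)
    fix u v assume "(u, v) \<in> lattice_rel A"
    then obtain w where "v - u = A *v w"
      by (auto simp: lattice_rel_def image_lattice_def)
    then have "u - v = A *v (- w)"
      by (metis minus_diff_eq add.inverse_unique add.right_inverse matrix_vector_mult_0_right
          matrix_vector_right_distrib)
    then show "(v, u) \<in> lattice_rel A"
      by (auto simp: lattice_rel_def image_lattice_def)
  qed
  show "trans (lattice_rel A)"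
  proof (rule transI)
    fix u v w assume "(u, v) \<in> lattice_rel A" "(v, w) \<in> lattice_rel A"
    then obtain a b where "v - u = A *v a" "w - v = A *v b"
      by (auto simp: lattice_rel_def image_lattice_def)
    then have "w - u = A *v (a + b)"
      by (simp add: matrix_vector_right_distrib) (metis add.commute diff_add_cancel add_diff_eq)
    then show "(u, w) \<in> lattice_rel A"
      by (auto simp: lattice_rel_def image_lattice_def)
  qed
qed auto

end

theory Submission
  imports Defs
begin

text \<open>A conjugacy is continuous, so near the zero point each coordinate of the image
  is already determined by one coordinate of the argument. A vector that fixes this
  coordinate then fixes the coordinate of the image; since the stabilizer of a coset
  of a lattice is the lattice itself, continuity turns into an inclusion of lattices.
  Conversely, such inclusions let one read off every coordinate of the image as a coarsening of
  a coordinate of the argument. Hence two odometers are conjugate precisely if each lattice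
  of either sequence contains a lattice of the other
  (\<open>conjugate_odometers_iff_cofinal\<close>).

  What remains is arithmetic with lattices. Membership in the lattice of a diagonal matrix is
  divisibility of the coordinates by the diagonal entries. A lattice \<open>A \<int>\<^sup>d\<close> is therefore
  contained in \<open>D \<int>\<^sup>d\<close> iff the diagonal entries of \<open>D\<close> divide the
  rows of \<open>A\<close>, and it contains \<open>D \<int>\<^sup>d\<close> iff it contains the
  multiples \<open>D $ k $ k\<close> of the axes, that is, iff its axis orders divide these
  entries. Among the diagonal lattices inside \<open>A \<int>\<^sup>d\<close> the one generated
  by the axis orders of \<open>A\<close> is thus the largest. If \<open>A (r (n + 1)) \<int>\<^sup>d\<close> and \<open>A (r n) \<int>\<^sup>d\<close>
  have any diagonal lattice between them, they have this one between them,
  which is the stated divisibility of rows; conversely, this divisibility makes these largest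
  diagonal lattices into a sequence interleaved with the subsequence.\<close>

section \<open>Image lattices\<close>

lemma image_lattice_0 [simp]: "0 \<in> image_lattice A"
  unfolding image_lattice_def by (rule range_eqI[of _ _ 0]) simp

lemma image_lattice_add:
  assumes "u \<in> image_lattice A" "v \<in> image_lattice A"
  shows "u + v \<in> image_lattice A"
  using assms unfolding image_lattice_def
  by (auto simp flip: matrix_vector_right_distrib)

lemma image_lattice_smult:
  assumes "v \<in> image_lattice A"
  shows "c *s v \<in> image_lattice A"
proof -
  obtain w where "v = A *v w"
    using assms by (auto simp: image_lattice_def)
  then have "c *s v = A *v (c *s w)"
    by (simp add: vec_eq_iff matrix_vector_mult_def sum_distrib_left mult.left_commute)
  then show ?thesis
    by (auto simp: image_lattice_def)
qed

lemma image_lattice_minus: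
  assumes "v \<in> image_lattice A"
  shows "- v \<in> image_lattice A"
  using image_lattice_smult[OF assms, of "-1"] by (simp flip: vector_sneg_minus1)

lemma image_lattice_diff:
  assumes "u \<in> image_lattice A" "v \<in> image_lattice A"
  shows "u - v \<in> image_lattice A"
  using image_lattice_add[OF assms(1) image_lattice_minus[OF assms(2)]] by simp

lemma image_lattice_sum:
  assumes "\<And>i. i \<in> I \<Longrightarrow> f i \<in> image_lattice A"
  shows "sum f I \<in> image_lattice A"
  using assms by (induction I rule: infinite_finite_induct) (auto intro: image_lattice_add)

lemma dvd_row_iff_image_lattice:
  "dvd_row m k A \<longleftrightarrow> (\<forall>v \<in> image_lattice A. m dvd v $ k)"
proof
  assume "dvd_row m k A"
  then show "\<forall>v \<in> image_lattice A. m dvd v $ k"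
    by (auto simp: image_lattice_def matrix_vector_mult_def dvd_row_def row_def intro!: dvd_sum)
next
  assume *: "\<forall>v \<in> image_lattice A. m dvd v $ k"
  have "m dvd A $ k $ j" for j
  proof -
    have "(A *v axis j 1) $ k = A $ k $ j"
      by (simp add: matrix_vector_mult_def axis_def if_distrib cong: if_cong)
    then show ?thesis
      using * by (metis image_lattice_def rangeI)
  qed
  then show "dvd_row m k A"
    by (simp add: dvd_row_def row_def)
qed

lemma image_lattice_diagonal:
  assumes "diagonal_matrix D"
  shows "v \<in> image_lattice D \<longleftrightarrow> (\<forall>k. D $ k $ k dvd v $ k)"
proof -
  have coord: "(D *v w) $ k = D $ k $ k * w $ k" for w k
  proof -
    have "(D *v w) $ k = (\<Sum>j\<in>UNIV. D $ k $ j * w $ j)"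
      by (simp add: matrix_vector_mult_def)
    also have "\<dots> = (\<Sum>j\<in>UNIV. if j = k then D $ k $ k * w $ k else 0)"
      by (rule sum.cong) (use assms in \<open>auto simp: diagonal_matrix_def\<close>)
    finally show ?thesis by simp
  qed
  show ?thesis
  proof
    assume "\<forall>k. D $ k $ k dvd v $ k"
    then have "v = D *v (\<chi> k. v $ k div D $ k $ k)"
      by (simp add: vec_eq_iff coord)
    then show "v \<in> image_lattice D"
      by (auto simp: image_lattice_def)
  qed (auto simp: image_lattice_def coord)
qed

text \<open>By Cramer's rule the solution of \<open>A w = det A v\<close> over the reals has determinants of
  integer matrices as coordinates, so it is an integer vector. In particular a nonsingular
  lattice contains a positive multiple of every axis vector, which is what makes
  the minimum in the definition of \<^const>\<open>axis_order\<close> exist.\<close>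
lemma det_smult_mem_image_lattice:
  fixes A :: "int^'d^'d"
  assumes "det A \<noteq> 0"
  shows "det A *s v \<in> image_lattice A"
proof -
  let ?R = "\<lambda>M :: int^'d^'d. (\<chi> i j. real_of_int (M $ i $ j))"
  have det_R: "det (?R M) = real_of_int (det M)" for M :: "int^'d^'d"
    by (simp add: det_def of_int_sum of_int_prod)
  \<comment> \<open>The numerators in Cramer's rule.\<close>
  define w :: "int^'d" where
    "w = (\<chi> k. det (\<chi> i j. if j = k then v $ i else A $ i $ j))"
  let ?b = "\<chi> i. real_of_int (v $ i)"
  let ?x = "\<chi> k. det (\<chi> i j. if j = k then ?b $ i else ?R A $ i $ j) / det (?R A)"
  have nz: "det (?R A) \<noteq> 0"
    using assms det_R by simp
  have sol: "?R A *v ?x = ?b"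
    using cramer[OF nz] by blast
  have x: "?x $ k = real_of_int (w $ k) / real_of_int (det A)" for k
    by (simp add: w_def det_R if_distrib flip: det_R cong: if_cong)
  have "real_of_int ((A *v w) $ i) = real_of_int ((det A *s v) $ i)" for i
  proof -
    have "(?R A *v ?x) $ i = (\<Sum>j\<in>UNIV. A $ i $ j * (w $ j / real_of_int (det A)))"
      unfolding matrix_vector_mult_def by (simp only: vec_lambda_beta x[unfolded vec_lambda_beta])
    then have "real_of_int (v $ i) = (\<Sum>j\<in>UNIV. A $ i $ j * (w $ j / real_of_int (det A)))"
      unfolding sol by simp
    then show ?thesis
      using assms by (simp add: matrix_vector_mult_def field_simps flip: sum_divide_distrib)
  qed
  then have "det A *s v = A *v w"
    by (simp only: of_int_eq_iff vec_eq_iff) simp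
  then show ?thesis
    by (auto simp: image_lattice_def)
qed

lemma axis_order_props:
  fixes A :: "int^'d^'d"
  assumes "det A \<noteq> 0"
  shows axis_order_pos: "1 \<le> axis_order k A"
    and axis_order_mem: "int (axis_order k A) *s axis k 1 \<in> image_lattice A"
proof -
  let ?P = "\<lambda>m. 1 \<le> m \<and> int m *s axis k 1 \<in> image_lattice A"
  have "\<bar>det A\<bar> *s axis k 1 \<in> image_lattice A"
    using image_lattice_smult[OF det_smult_mem_image_lattice[OF assms], of "sgn (det A)" "axis k 1"]
    by (simp add: vector_smult_assoc mult.commute abs_sgn)
  then have "?P (nat \<bar>det A\<bar>)"
    using assms by simp
  then have "?P (axis_order k A)"
    unfolding axis_order_def by (rule LeastI)
  then show "1 \<le> axis_order k A" "int (axis_order k A) *s axis k 1 \<in> image_lattice A"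
    by auto
qed

text \<open>The integers \<open>c\<close> whose multiple of the axis vector lies in the lattice form a subgroup
  of \<open>\<int>\<close>, and the least positive element of such a subgroup generates it.\<close>
lemma axis_order_dvd_iff:
  fixes A :: "int^'d^'d"
  assumes "det A \<noteq> 0"
  shows "int (axis_order k A) dvd c \<longleftrightarrow> c *s axis k 1 \<in> image_lattice A"
proof
  assume "int (axis_order k A) dvd c"
  then obtain q where c: "c = q * int (axis_order k A)"
    by (metis dvdE mult.commute)
  have "c *s axis k 1 = q *s (int (axis_order k A) *s axis k 1)"
    by (simp only: c vector_smult_assoc)
  then show "c *s axis k 1 \<in> image_lattice A"
    using image_lattice_smult[OF axis_order_mem[OF assms]] by metis
next
  assume c: "c *s axis k 1 \<in> image_lattice A"
  let ?m = "int (axis_order k A)" and ?e = "axis k 1 :: int^'d"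
  define t where "t = nat (c mod ?m)"
  have m: "?m > 0"
    using axis_order_pos[OF assms, of k] by simp
  have t: "int t = c - c div ?m * ?m"
    using m by (simp add: t_def minus_div_mult_eq_mod)
  have "int t *s ?e = c *s ?e - (c div ?m) *s (?m *s ?e)"
    by (simp add: t vector_sub_rdistrib vector_smult_assoc)
  then have mem: "int t *s ?e \<in> image_lattice A"
    using image_lattice_diff[OF c image_lattice_smult[OF axis_order_mem[OF assms]]] by metis
  have "t < axis_order k A"
    using m pos_mod_bound[OF m, of c] by (simp add: t_def nat_less_iff)
  then have "\<not> 1 \<le> t"
    using mem not_less_Least unfolding axis_order_def by blast
  then have "c = c div ?m * ?m"
    using t by simp
  then show "?m dvd c"
    by (metis dvd_triv_right)
qed

lemma image_lattice_subset_diagonal_iff: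
  assumes "diagonal_matrix D"
  shows "image_lattice A \<subseteq> image_lattice D \<longleftrightarrow> (\<forall>k. dvd_row (D $ k $ k) k A)"
  by (auto simp: subset_iff image_lattice_diagonal[OF assms] dvd_row_iff_image_lattice)

text \<open>A diagonal lattice is spanned by multiples of the axis vectors, so only these have to be
  tested.\<close>
lemma diagonal_image_lattice_subset_iff:
  fixes A :: "int^'d^'d"
  assumes "diagonal_matrix D" "det A \<noteq> 0"
  shows "image_lattice D \<subseteq> image_lattice A \<longleftrightarrow> (\<forall>k. int (axis_order k A) dvd D $ k $ k)"
proof
  assume sub: "image_lattice D \<subseteq> image_lattice A"
  have "D $ k $ k *s axis k 1 \<in> image_lattice D" for k
    by (simp add: image_lattice_diagonal[OF assms(1)] axis_def)
  with sub show "\<forall>k. int (axis_order k A) dvd D $ k $ k"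
    by (auto simp: axis_order_dvd_iff[OF assms(2)])
next
  assume *: "\<forall>k. int (axis_order k A) dvd D $ k $ k"
  show "image_lattice D \<subseteq> image_lattice A"
  proof
    fix v assume "v \<in> image_lattice D"
    then have "v $ k *s axis k 1 \<in> image_lattice A" for k
      using * by (metis assms axis_order_dvd_iff dvd_trans image_lattice_diagonal)
    then have "(\<Sum>k\<in>UNIV. v $ k *s axis k 1) \<in> image_lattice A"
      by (intro image_lattice_sum)
    then show "v \<in> image_lattice A"
      by (simp add: basis_expansion)
  qed
qed

lemma odometer_sequence_decreasing:
  assumes "odometer_sequence A" "m \<le> n"
  shows "image_lattice (A n) \<subseteq> image_lattice (A m)"
  using assms(1) lift_Suc_antimono_le[of "\<lambda>n. image_lattice (A n)" m n] assms(2)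
  by (auto simp: odometer_sequence_def)

section \<open>Points of an odometer\<close>

lemma lattice_rel_Image: "lattice_rel A `` S = {v. \<exists>u\<in>S. v - u \<in> image_lattice A}"
  by (auto simp: lattice_rel_def)

text \<open>The quotient maps compose: saturating under a small lattice and then under a larger one is
  the same as saturating under the larger one at once.\<close>
lemma lattice_rel_Image_absorb:
  assumes "image_lattice A \<subseteq> image_lattice B"
  shows "lattice_rel B `` (lattice_rel A `` S) = lattice_rel B `` S"
proof -
  have "lattice_rel A \<subseteq> lattice_rel B"
    using assms by (auto simp: lattice_rel_def)
  moreover have "Id \<subseteq> lattice_rel A" "trans (lattice_rel B)"
    using equiv_lattice_rel by (auto simp: equiv_def refl_on_def)
  ultimately have "lattice_rel A O lattice_rel B = lattice_rel B"
    by (auto dest: transD)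
  then show ?thesis
    by (metis relcomp_Image)
qed

lemma quotient_space_iff: "S \<in> quotient_space A \<longleftrightarrow> (\<exists>s. S = lattice_rel A `` {s})"
  by (auto simp: quotient_space_def quotient_def)

lemma lattice_rel_Image_mem_quotient_space:
  assumes "S \<in> quotient_space A" "image_lattice A \<subseteq> image_lattice B"
  shows "lattice_rel B `` S \<in> quotient_space B"
proof -
  obtain s where "S = lattice_rel A `` {s}"
    using assms(1) quotient_space_iff by blast
  then have "lattice_rel B `` S = lattice_rel B `` {s}"
    using lattice_rel_Image_absorb[OF assms(2)] by (simp only:)
  then show ?thesis
    using quotient_space_iff by blast
qed

lemma lattice_rel_Image_quotient_space:
  assumes "S \<in> quotient_space A"
  shows "lattice_rel A `` S = S"
proof -
  obtain s where "S = lattice_rel A `` {s}"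
    using assms quotient_space_iff by blast
  then show ?thesis
    by (simp only: lattice_rel_Image_absorb[OF order_refl])
qed

lemma lattice_rel_Image_translate:
  "lattice_rel A `` ((\<lambda>u. v + u) ` S) = (\<lambda>u. v + u) ` (lattice_rel A `` S)"
proof -
  have "w \<in> (\<lambda>u. v + u) ` (lattice_rel A `` S)" if "u \<in> S" "w - (v + u) \<in> image_lattice A" for u w
    by (rule image_eqI[of _ _ "w - v"]) (use that in \<open>auto simp: lattice_rel_Image algebra_simps\<close>)
  then show ?thesis
    by (auto simp: lattice_rel_Image)
qed

lemma translate_coset: "(\<lambda>u. v + u) ` (lattice_rel A `` {s}) = lattice_rel A `` {v + s}"
  using lattice_rel_Image_translate[of A v "{s}"] by simp

text \<open>Lattices are recovered from the action as stabilizers of cosets.\<close>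
lemma translate_quotient_space_fixed_iff:
  assumes "S \<in> quotient_space A"
  shows "(\<lambda>u. v + u) ` S = S \<longleftrightarrow> v \<in> image_lattice A"
proof -
  obtain s where S: "S = lattice_rel A `` {s}"
    using assms quotient_space_iff by blast
  have "(\<lambda>u. v + u) ` S = lattice_rel A `` {v + s}"
    unfolding S by (rule translate_coset)
  also have "\<dots> = S \<longleftrightarrow> (v + s, s) \<in> lattice_rel A"
    unfolding S using equiv_lattice_rel[of A] by (simp add: eq_equiv_class_iff)
  also have "\<dots> \<longleftrightarrow> v \<in> image_lattice A"
    using image_lattice_minus[of v A] image_lattice_minus[of "- v" A] by (auto simp: lattice_rel_def)
  finally show ?thesis .
qed

text \<open>The compatibility equation is oriented so that it removes the later coordinate when used for
  rewriting; the opposite orientation unfolds every coordinate without end.\<close>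
lemma topspace_odometer:
  "x \<in> topspace (odometer A) \<longleftrightarrow>
     (\<forall>n. x n \<in> quotient_space (A n)) \<and> (\<forall>n. lattice_rel (A n) `` x (Suc n) = x n)"
  by (auto simp: odometer_def PiE_iff)

lemma odometer_coordinate:
  assumes "odometer_sequence A" "x \<in> topspace (odometer A)" "m \<le> n"
  shows "x m = lattice_rel (A m) `` x n"
  using assms(3)
proof (induction n rule: dec_induct)
  case base
  show ?case
    using assms(2) by (simp add: topspace_odometer lattice_rel_Image_quotient_space)
next
  case (step n)
  have "x n = lattice_rel (A n) `` x (Suc n)"
    using assms(2) by (simp add: topspace_odometer)
  then have "x m = lattice_rel (A m) `` (lattice_rel (A n) `` x (Suc n))"
    using step.IH by (simp only:)
  then show ?case
    by (simp only: lattice_rel_Image_absorb[OF odometer_sequence_decreasing[OF assms(1) step.hyps(1)]])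
qed

text \<open>Any coordinate fine enough to determine a coset of \<open>C\<close> determines the same coset. This
  makes the maps between odometers below independent of the choice of coordinates.\<close>
lemma odometer_coordinate_coarsen:
  assumes "odometer_sequence A" "x \<in> topspace (odometer A)"
    and "image_lattice (A m) \<subseteq> image_lattice C" "image_lattice (A n) \<subseteq> image_lattice C"
  shows "lattice_rel C `` x m = lattice_rel C `` x n"
proof -
  have "lattice_rel C `` x i = lattice_rel C `` x j"
    if "i \<le> j" "image_lattice (A i) \<subseteq> image_lattice C" for i j
    by (subst odometer_coordinate[OF assms(1,2) that(1)]) (rule lattice_rel_Image_absorb[OF that(2)])
  with assms show ?thesis
    by (metis nat_le_linear)
qed

lemma translate_mem_odometer:
  assumes "x \<in> topspace (odometer A)"
  shows "translate v x \<in> topspace (odometer A)"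
proof -
  have "(\<lambda>u. v + u) ` x n \<in> quotient_space (A n)" for n
    using assms translate_coset unfolding topspace_odometer quotient_space_iff by metis
  then show ?thesis
    using assms by (simp add: topspace_odometer translate_def lattice_rel_Image_translate)
qed

lemma zero_coset_mem_odometer:
  assumes "odometer_sequence A"
  shows "(\<lambda>n. lattice_rel (A n) `` {0}) \<in> topspace (odometer A)"
proof -
  have "lattice_rel (A n) `` (lattice_rel (A (Suc n)) `` {0}) = lattice_rel (A n) `` {0}" for n
    using assms by (intro lattice_rel_Image_absorb) (simp add: odometer_sequence_def)
  then show ?thesis
    by (auto simp: topspace_odometer quotient_space_iff)
qed

text \<open>A basic open set of the product restricts finitely many coordinates, and in an odometer the
  last of these determines all the others.\<close>
lemma odometer_open_nbhd:
  assumes A: "odometer_sequence A" and U: "openin (odometer A) U" and x: "x \<in> U"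
  obtains m where "\<And>y. y \<in> topspace (odometer A) \<Longrightarrow> y m = x m \<Longrightarrow> y \<in> U"
proof -
  let ?X = "\<lambda>n. discrete_topology (quotient_space (A n))"
  obtain V where V: "openin (product_topology ?X UNIV) V"
      "U = V \<inter> {x. \<forall>n. x n = lattice_rel (A n) `` x (Suc n)}"
    using U unfolding odometer_def openin_subtopology by blast
  then obtain W where W: "finite {i. W i \<noteq> topspace (?X i)}" "x \<in> Pi\<^sub>E UNIV W" "Pi\<^sub>E UNIV W \<subseteq> V"
    using x unfolding openin_product_topology_alt by fastforce
  obtain m where m: "\<And>i. W i \<noteq> topspace (?X i) \<Longrightarrow> i \<le> m"
    using W(1) finite_nat_set_iff_bounded_le by auto
  have xA: "x \<in> topspace (odometer A)"
    using U x openin_subset by blast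
  show thesis
  proof (rule that)
    fix y assume y: "y \<in> topspace (odometer A)" "y m = x m"
    have "y i \<in> W i" for i
    proof (cases "i \<le> m")
      case True
      then have "y i = x i"
        using odometer_coordinate[OF A y(1)] odometer_coordinate[OF A xA] y(2) by metis
      then show ?thesis
        using W(2) by auto
    next
      case False
      then have "W i = topspace (?X i)"
        using m by blast
      then show ?thesis
        using y(1) by (simp add: topspace_odometer)
    qed
    then have "y \<in> V"
      using W(3) by (auto simp: PiE_iff)
    then show "y \<in> U"
      using y(1) V(2) by (simp add: topspace_odometer)
  qed
qed

section \<open>Conjugacy as mutual cofinality of lattices\<close>

definition lattices_cofinal :: "(nat \<Rightarrow> int^'d^'d) \<Rightarrow> (nat \<Rightarrow> int^'d^'d) \<Rightarrow> bool" where
  "lattices_cofinal A B \<longleftrightarrow> (\<forall>n. \<exists>m. image_lattice (A m) \<subseteq> image_lattice (B n))"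

text \<open>The set of points whose image shares its \<open>n\<close>th coordinate with the image of the zero
  point is open, hence contains every point that agrees with the zero point in some coordinate
  \<open>m\<close>. Translates by vectors of \<open>A m \<int>\<^sup>d\<close> are of this kind, so by
  equivariance such vectors stabilize a coset of \<open>B n \<int>\<^sup>d\<close>.\<close>
lemma lattices_cofinal_of_equivariant_map:
  assumes A: "odometer_sequence A"
    and h: "continuous_map (odometer A) (odometer B) h"
    and eq: "\<And>v x. x \<in> topspace (odometer A) \<Longrightarrow> h (translate v x) = translate v (h x)"
  shows "lattices_cofinal A B"
  unfolding lattices_cofinal_def
proof
  fix n
  define x where "x = (\<lambda>n. lattice_rel (A n) `` {0})"
  have x: "x \<in> topspace (odometer A)"
    using zero_coset_mem_odometer[OF A] by (simp add: x_def)
  have hx: "h x \<in> topspace (odometer B)"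
    using h x by (auto simp: continuous_map_def)
  let ?U = "{y \<in> topspace (odometer A). h y n \<in> {h x n}}"
  have "continuous_map (odometer B) (discrete_topology (quotient_space (B n))) (\<lambda>y. y n)"
    unfolding odometer_def by (intro continuous_intros) auto
  from continuous_map_compose[OF h this]
  have "openin (odometer A) ?U"
    using hx by (intro openin_continuous_map_preimage) (auto simp: o_def topspace_odometer)
  then obtain m where m: "\<And>y. y \<in> topspace (odometer A) \<Longrightarrow> y m = x m \<Longrightarrow> y \<in> ?U"
    using odometer_open_nbhd[OF A, of ?U x] x by blast
  have "image_lattice (A m) \<subseteq> image_lattice (B n)"
  proof
    fix v assume "v \<in> image_lattice (A m)"
    then have "translate v x m = x m"
      using x translate_quotient_space_fixed_iff[of "x m" "A m" v]
      by (simp add: translate_def topspace_odometer)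
    then have "h (translate v x) n = h x n"
      using m[OF translate_mem_odometer[OF x]] by simp
    then have "(\<lambda>u. v + u) ` h x n = h x n"
      by (simp add: eq[OF x]) (simp add: translate_def)
    then show "v \<in> image_lattice (B n)"
      using hx translate_quotient_space_fixed_iff[of "h x n" "B n" v]
      by (simp add: topspace_odometer)
  qed
  then show "\<exists>m. image_lattice (A m) \<subseteq> image_lattice (B n)" ..
qed

text \<open>The map of odometers induced by inclusions of \<open>A (f n) \<int>\<^sup>d\<close> in
  \<open>B n \<int>\<^sup>d\<close>.\<close>
definition coarsening :: "(nat \<Rightarrow> nat) \<Rightarrow> (nat \<Rightarrow> int^'d^'d) \<Rightarrow>
    (nat \<Rightarrow> (int^'d) set) \<Rightarrow> nat \<Rightarrow> (int^'d) set" where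
  "coarsening f B x = (\<lambda>n. lattice_rel (B n) `` x (f n))"

lemma translate_coarsening: "coarsening f B (translate v x) = translate v (coarsening f B x)"
  by (simp add: coarsening_def translate_def lattice_rel_Image_translate)

lemma continuous_map_coarsening:
  assumes A: "odometer_sequence A" and B: "odometer_sequence B"
    and f: "\<And>n. image_lattice (A (f n)) \<subseteq> image_lattice (B n)"
  shows "continuous_map (odometer A) (odometer B) (coarsening f B)"
proof -
  let ?Q = "\<lambda>C. discrete_topology (quotient_space C)"
  have "continuous_map (odometer A) (?Q (B n)) (\<lambda>x. coarsening f B x n)" for n
  proof -
    have "continuous_map (odometer A) (?Q (A (f n))) (\<lambda>x. x (f n))"
      unfolding odometer_def by (intro continuous_intros) auto
    moreover have "continuous_map (?Q (A (f n))) (?Q (B n)) (\<lambda>S. lattice_rel (B n) `` S)"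
      using lattice_rel_Image_mem_quotient_space[OF _ f] by (simp add: Pi_iff)
    ultimately show ?thesis
      unfolding coarsening_def by (rule continuous_map_compose[unfolded o_def])
  qed
  then have "continuous_map (odometer A) (product_topology (\<lambda>n. ?Q (B n)) UNIV) (coarsening f B)"
    by (simp only: continuous_map_componentwise_UNIV) blast
  moreover have "coarsening f B x n = lattice_rel (B n) `` coarsening f B x (Suc n)"
    if x: "x \<in> topspace (odometer A)" for x n
  proof -
    have BS: "image_lattice (B (Suc n)) \<subseteq> image_lattice (B n)"
      using B by (simp add: odometer_sequence_def)
    have "lattice_rel (B n) `` x (f n) = lattice_rel (B n) `` x (f (Suc n))"
      using odometer_coordinate_coarsen[OF A x f[of n]] f[of "Suc n"] BS by blast
    then show ?thesis
      by (simp add: coarsening_def lattice_rel_Image_absorb[OF BS])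
  qed
  ultimately show ?thesis
    unfolding odometer_def[of B] continuous_map_in_subtopology by blast
qed

text \<open>Going back and forth coarsens some later coordinate to the \<open>n\<close>th one, which compatibility
  says is the \<open>n\<close>th coordinate itself.\<close>
lemma coarsening_inverse:
  assumes A: "odometer_sequence A"
    and f: "\<And>n. image_lattice (A (f n)) \<subseteq> image_lattice (B n)"
    and g: "\<And>n. image_lattice (B (g n)) \<subseteq> image_lattice (A n)"
    and x: "x \<in> topspace (odometer A)"
  shows "coarsening g A (coarsening f B x) = x"
proof
  fix n
  have "coarsening g A (coarsening f B x) n = lattice_rel (A n) `` x (f (g n))"
    by (simp add: coarsening_def lattice_rel_Image_absorb[OF g])
  also have "\<dots> = lattice_rel (A n) `` x n"
    using odometer_coordinate_coarsen[OF A x] f g by (meson order.trans order_refl)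
  also have "\<dots> = x n"
    using x by (simp add: topspace_odometer lattice_rel_Image_quotient_space)
  finally show "coarsening g A (coarsening f B x) n = x n" .
qed

lemma conjugate_odometers_iff_cofinal:
  assumes A: "odometer_sequence A" and B: "odometer_sequence B"
  shows "conjugate_odometers A B \<longleftrightarrow> lattices_cofinal A B \<and> lattices_cofinal B A"
proof
  assume "conjugate_odometers A B"
  then obtain h k where hk: "homeomorphic_maps (odometer A) (odometer B) h k"
    and eq: "\<And>v x. x \<in> topspace (odometer A) \<Longrightarrow> h (translate v x) = translate v (h x)"
    unfolding conjugate_odometers_def homeomorphic_map_maps by blast
  have h: "continuous_map (odometer A) (odometer B) h"
    and k: "continuous_map (odometer B) (odometer A) k"
    and kh: "\<And>x. x \<in> topspace (odometer A) \<Longrightarrow> k (h x) = x"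
    and hk: "\<And>y. y \<in> topspace (odometer B) \<Longrightarrow> h (k y) = y"
    using hk by (auto simp: homeomorphic_maps_def)
  have "k (translate v y) = translate v (k y)" if y: "y \<in> topspace (odometer B)" for v y
  proof -
    have ky: "k y \<in> topspace (odometer A)"
      using k y by (auto simp: continuous_map_def)
    have "k (translate v y) = k (h (translate v (k y)))"
      by (simp add: eq[OF ky] hk[OF y])
    also have "\<dots> = translate v (k y)"
      by (rule kh[OF translate_mem_odometer[OF ky]])
    finally show ?thesis .
  qed
  then show "lattices_cofinal A B \<and> lattices_cofinal B A"
    using lattices_cofinal_of_equivariant_map[OF A h eq] lattices_cofinal_of_equivariant_map[OF B k]
    by blast
next
  assume "lattices_cofinal A B \<and> lattices_cofinal B A"
  then obtain f g where f: "\<And>n. image_lattice (A (f n)) \<subseteq> image_lattice (B n)"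
    and g: "\<And>n. image_lattice (B (g n)) \<subseteq> image_lattice (A n)"
    unfolding lattices_cofinal_def by metis
  have "homeomorphic_maps (odometer A) (odometer B) (coarsening f B) (coarsening g A)"
    unfolding homeomorphic_maps_def
    using continuous_map_coarsening[OF A B f] continuous_map_coarsening[OF B A g]
      coarsening_inverse[of A f B g] coarsening_inverse[of B g A f] A B f g by blast
  then show "conjugate_odometers A B"
    unfolding conjugate_odometers_def
    using homeomorphic_maps_imp_map translate_coarsening by blast
qed

section \<open>Product odometers\<close>

text \<open>Below every \<open>A p \<int>\<^sup>d\<close> there is a diagonal lattice, and below that some
  \<open>A q \<int>\<^sup>d\<close>. The axis orders of \<open>A p\<close> divide the diagonal entries, which in turn
  divide the rows of \<open>A q\<close>; the subsequence repeats this step.\<close>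
lemma dvd_row_subsequence_of_cofinal_diagonal:
  fixes A :: "nat \<Rightarrow> int^'d^'d"
  assumes A: "odometer_sequence A" and D: "\<And>n. diagonal_matrix (D n)"
    and AD: "lattices_cofinal A D" and DA: "lattices_cofinal D A"
  obtains r :: "nat \<Rightarrow> nat" where "strict_mono r"
    "\<And>n k. dvd_row (int (axis_order k (A (r n)))) k (A (r (Suc n)))"
proof -
  have step: "\<exists>q>p. \<forall>k. dvd_row (int (axis_order k (A p))) k (A q)" for p
  proof -
    obtain m where m: "image_lattice (D m) \<subseteq> image_lattice (A p)"
      using DA unfolding lattices_cofinal_def by blast
    obtain q where q: "image_lattice (A q) \<subseteq> image_lattice (D m)"
      using AD unfolding lattices_cofinal_def by blast
    \<comment> \<open>The inclusion survives an increase of the index, and the subsequence has to increase strictly.\<close>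
    let ?q = "max q (Suc p)"
    have "image_lattice (A ?q) \<subseteq> image_lattice (D m)"
      using q odometer_sequence_decreasing[OF A, of q ?q] by simp
    then have "dvd_row (D m $ k $ k) k (A ?q)" for k
      by (simp add: image_lattice_subset_diagonal_iff[OF D])
    moreover have "int (axis_order k (A p)) dvd D m $ k $ k" for k
      using m A by (simp add: diagonal_image_lattice_subset_iff[OF D] odometer_sequence_def)
    ultimately have "dvd_row (int (axis_order k (A p))) k (A ?q)" for k
      unfolding dvd_row_def by (meson dvd_trans)
    then show ?thesis
      by (intro exI[of _ ?q]) simp
  qed
  have "\<exists>r. \<forall>n. True \<and> (r n < r (Suc n) \<and>
      (\<forall>k. dvd_row (int (axis_order k (A (r n)))) k (A (r (Suc n)))))"
    by (rule dependent_nat_choice) (use step in auto)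
  then show thesis
    using that by (auto simp: strict_mono_Suc_iff)
qed

text \<open>Its image is the largest diagonal lattice inside the image of \<open>A\<close>.\<close>
definition axis_order_matrix :: "int^'d^'d \<Rightarrow> int^'d^'d" where
  "axis_order_matrix A = (\<chi> i j. if i = j then int (axis_order i A) else 0)"

lemma diagonal_axis_order_matrix: "diagonal_matrix (axis_order_matrix A)"
  by (simp add: diagonal_matrix_def axis_order_matrix_def)

lemma det_axis_order_matrix:
  fixes A :: "int^'d^'d"
  assumes "det A \<noteq> 0"
  shows "det (axis_order_matrix A) \<noteq> 0"
proof -
  have "axis_order k A \<noteq> 0" for k
    using axis_order_pos[OF assms, of k] by simp
  then show ?thesis
    using diagonal_axis_order_matrix[of A]
    by (subst det_diagonal) (auto simp: diagonal_matrix_def axis_order_matrix_def)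
qed

lemma axis_order_matrix_subset:
  fixes A :: "int^'d^'d"
  assumes "det A \<noteq> 0"
  shows "image_lattice (axis_order_matrix A) \<subseteq> image_lattice A"
  using assms
  by (simp add: diagonal_image_lattice_subset_iff[OF diagonal_axis_order_matrix])
    (simp add: axis_order_matrix_def)

lemma subset_axis_order_matrix_iff:
  "image_lattice B \<subseteq> image_lattice (axis_order_matrix A) \<longleftrightarrow>
     (\<forall>k. dvd_row (int (axis_order k A)) k B)"
  by (simp add: image_lattice_subset_diagonal_iff[OF diagonal_axis_order_matrix])
    (simp add: axis_order_matrix_def)

text \<open>The lattices interleave: \<open>A (r (n + 1)) \<int>\<^sup>d \<subseteq> D n \<int>\<^sup>d \<subseteq> A (r n) \<int>\<^sup>d\<close>.
  So the diagonal lattices decrease to zero together with those of \<open>A\<close>.\<close>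
lemma cofinal_axis_order_matrices:
  fixes A :: "nat \<Rightarrow> int^'d^'d"
  assumes A: "odometer_sequence A" and r: "strict_mono r"
    and dvd: "\<And>n k. dvd_row (int (axis_order k (A (r n)))) k (A (r (Suc n)))"
  defines "D \<equiv> \<lambda>n. axis_order_matrix (A (r n))"
  shows "product_odometer_sequence D" "lattices_cofinal A D" "lattices_cofinal D A"
proof -
  have det: "det (A n) \<noteq> 0" for n
    using A by (simp add: odometer_sequence_def)
  have DA: "image_lattice (D n) \<subseteq> image_lattice (A (r n))" for n
    unfolding D_def by (rule axis_order_matrix_subset[OF det])
  have AD: "image_lattice (A (r (Suc n))) \<subseteq> image_lattice (D n)" for n
    using dvd by (simp add: D_def subset_axis_order_matrix_iff)
  have DA': "image_lattice (D n) \<subseteq> image_lattice (A n)" for n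
    using DA odometer_sequence_decreasing[OF A seq_suble[OF r]] by blast
  have "(\<Inter>n. image_lattice (D n)) \<subseteq> {0}"
  proof -
    have "(\<Inter>n. image_lattice (D n)) \<subseteq> (\<Inter>n. image_lattice (A n))"
      using DA' by blast
    then show ?thesis
      using A by (simp add: odometer_sequence_def)
  qed
  then have "(\<Inter>n. image_lattice (D n)) = {0}"
    by auto
  moreover have "image_lattice (D (Suc n)) \<subseteq> image_lattice (D n)" for n
    using DA AD by blast
  moreover have "det (D n) \<noteq> 0" for n
    unfolding D_def by (rule det_axis_order_matrix[OF det])
  ultimately show "product_odometer_sequence D"
    by (simp add: product_odometer_sequence_def odometer_sequence_def)
      (simp add: D_def diagonal_axis_order_matrix)
  show "lattices_cofinal A D" "lattices_cofinal D A"
    using AD DA' unfolding lattices_cofinal_def by blast+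
qed

theorem proposition4p6:
  fixes A :: "nat \<Rightarrow> int^'d^'d"
  assumes "odometer_sequence A"
  shows "(\<exists>D. product_odometer_sequence D \<and> conjugate_odometers A D) \<longleftrightarrow>
         (\<exists>r :: nat \<Rightarrow> nat. strict_mono r \<and>
            (\<forall>n k. dvd_row (int (axis_order k (A (r n)))) k (A (r (Suc n)))))"
proof
  assume "\<exists>D. product_odometer_sequence D \<and> conjugate_odometers A D"
  then obtain D where D: "odometer_sequence D" "\<And>n. diagonal_matrix (D n)"
    and "conjugate_odometers A D"
    unfolding product_odometer_sequence_def by blast
  then have "lattices_cofinal A D" "lattices_cofinal D A"
    using conjugate_odometers_iff_cofinal[OF assms] by blast+
  then obtain r :: "nat \<Rightarrow> nat" where "strict_mono r"
    "\<And>n k. dvd_row (int (axis_order k (A (r n)))) k (A (r (Suc n)))"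
    using dvd_row_subsequence_of_cofinal_diagonal[of A D] assms D(2) by blast
  then show "\<exists>r :: nat \<Rightarrow> nat. strict_mono r \<and>
      (\<forall>n k. dvd_row (int (axis_order k (A (r n)))) k (A (r (Suc n))))"
    by blast
next
  assume "\<exists>r :: nat \<Rightarrow> nat. strict_mono r \<and>
      (\<forall>n k. dvd_row (int (axis_order k (A (r n)))) k (A (r (Suc n))))"
  then obtain r :: "nat \<Rightarrow> nat" where "strict_mono r"
    "\<And>n k. dvd_row (int (axis_order k (A (r n)))) k (A (r (Suc n)))"
    by blast
  note D = cofinal_axis_order_matrices[OF assms this]
  then have "conjugate_odometers A (\<lambda>n. axis_order_matrix (A (r n)))"
    using conjugate_odometers_iff_cofinal[OF assms] product_odometer_sequence_def by blast
  with D(1) show "\<exists>D. product_odometer_sequence D \<and> conjugate_odometers A D"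
    by blast
qed

end
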